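(* Let $n\ge 2$, let $\mathbb{M}^n=(\mathbb{R}^n,\|\cdot\|)$ be a Minkowski space with unit ball $\mathbb{B}$, and let $m\in\mathbb{N}$ with $m\ge 3$. Then the following are equivalent: (i) $\mathbb{B}$ has the $(m.2)$-intersection property. (ii) The convex hull $S$ of any $m$ points in $\mathbb{R}^n$ fulfills $D(S)=2R(S)$.
   Context: A Minkowski space is $\mathbb{R}^n$ with a norm $\|\cdot\|$; its unit ball is $\mathbb{B}=\{x:\|x\|\le 1\}$. For a convex body (non-empty, convex, compact set) $K\subset\mathbb{R}^n$: circumradius $R(K)=\inf\{\rho\ge 0:K\subset c+\rho\mathbb{B},\ c\in\mathbb{R}^n\}$; diameter $D(K)=\max_{x,y\in K}\|x-y\|$. For $m,k\in\mathbb{N}$ with $2\le k<m$, a convex body $C\subset\mathbb{R}^n$ has the $(m.k)$-intersection property if for every family of $m$ translations of $C$ such that every $k$ of them intersect (have a common point), all $m$ translations have a common point. *)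

theory Defs
  imports "HOL-Analysis.Analysis"
begin

text \<open>
  A Minkowski space is given by an arbitrary norm \<open>N\<close> on \<open>real ^ 'n\<close>, passed explicitly: the
  type-class norm on \<open>real ^ 'n\<close> is the Euclidean one.
\<close>

definition is_norm :: "(real ^ 'n \<Rightarrow> real) \<Rightarrow> bool" where
  "is_norm N \<longleftrightarrow>
     (\<forall>x. 0 \<le> N x) \<and>
     (\<forall>x. N x = 0 \<longleftrightarrow> x = 0) \<and>
     (\<forall>a x. N (a *\<^sub>R x) = \<bar>a\<bar> * N x) \<and>
     (\<forall>x y. N (x + y) \<le> N x + N y)"

definition unit_ball :: "(real ^ 'n \<Rightarrow> real) \<Rightarrow> (real ^ 'n) set" where
  "unit_ball N = {x. N x \<le> 1}"

definition circumradius :: "(real ^ 'n \<Rightarrow> real) \<Rightarrow> (real ^ 'n) set \<Rightarrow> real" where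
  "circumradius N K =
     Inf {\<rho>. 0 \<le> \<rho> \<and> (\<exists>c. K \<subseteq> (\<lambda>b. c + \<rho> *\<^sub>R b) ` unit_ball N)}"

text \<open>
  The supremum is a maximum when \<open>N\<close> is a norm and \<open>K\<close> is a convex body, since then \<open>K\<close> is
  non-empty and compact and \<open>N\<close> is continuous.
\<close>

definition diam :: "(real ^ 'n \<Rightarrow> real) \<Rightarrow> (real ^ 'n) set \<Rightarrow> real" where
  "diam N K = Sup {N (x - y) | x y. x \<in> K \<and> y \<in> K}"

text \<open>
  The family of \<open>m\<close> translations is indexed by \<open>{..<m}\<close>, so repeated members are allowed, and
  ``every \<open>k\<close> of them'' ranges over the \<open>k\<close>-element sets of indices. The notion is meant for
  convex bodies \<open>C\<close> and \<open>2 \<le> k < m\<close>.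
\<close>

definition intersection_property :: "nat \<Rightarrow> nat \<Rightarrow> (real ^ 'n) set \<Rightarrow> bool" where
  "intersection_property m k C \<longleftrightarrow>
     (\<forall>t :: nat \<Rightarrow> real ^ 'n.
        (\<forall>J. J \<subseteq> {..<m} \<and> card J = k \<longrightarrow> (\<Inter>i\<in>J. (\<lambda>x. t i + x) ` C) \<noteq> {}) \<longrightarrow>
        (\<Inter>i\<in>{..<m}. (\<lambda>x. t i + x) ` C) \<noteq> {})"

end

theory Submission
  imports Defs
begin

text \<open>
  Two translates \<open>s + \<bool>\<close> and \<open>t + \<bool>\<close> of the unit ball meet iff \<open>N (s - t) \<le> 2\<close>, and the
  translates by \<open>t i\<close> have a common point iff a single unit ball contains all the points \<open>t i\<close>.
  Thus the intersection property says that points with pairwise distances at most 2 lie in a unit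
  ball, which after scaling is \<open>2 * R \<le> D\<close>; the inequality \<open>D \<le> 2 * R\<close> is the triangle
  inequality. Compactness is needed in one direction, to attain the circumradius.
\<close>

context
  fixes N :: "real ^ 'n \<Rightarrow> real"
  assumes N: "is_norm N"
begin

section \<open>Elementary properties of the norm; its continuity and the convexity of its
  balls\<close>

lemma norm_nonneg: "0 \<le> N x"
  and norm_eq_0_iff: "N x = 0 \<longleftrightarrow> x = 0"
  and norm_scale: "N (a *\<^sub>R x) = \<bar>a\<bar> * N x"
  and norm_add_le: "N (x + y) \<le> N x + N y"
  using N unfolding is_norm_def by blast+

lemma norm_minus_commute: "N (x - y) = N (y - x)"
  using norm_scale[of "-1" "x - y"] by simp

lemma norm_triangle: "N (x - z) \<le> N (x - y) + N (y - z)"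
  using norm_add_le[of "x - y" "y - z"] by simp

lemma convex_on_norm: "convex_on UNIV N"
proof (rule convex_onI)
  fix t :: real and x y
  assume "0 < t" "t < 1"
  then show "N ((1 - t) *\<^sub>R x + t *\<^sub>R y) \<le> (1 - t) * N x + t * N y"
    using norm_add_le[of "(1 - t) *\<^sub>R x" "t *\<^sub>R y"] by (simp add: norm_scale)
qed simp

text \<open>A convex function on an open subset of a finite-dimensional space is continuous in the
  Euclidean topology.\<close>

lemma continuous_on_norm: "continuous_on A N"
  using convex_on_continuous[OF open_UNIV convex_on_norm] continuous_on_subset by blast

lemma convex_norm_ball: "convex {x. N (x - c) \<le> r}"
proof (rule convexI, clarsimp)
  fix x y and u v :: real
  assume xy: "N (x - c) \<le> r" "N (y - c) \<le> r" and uv: "0 \<le> u" "0 \<le> v" "u + v = 1"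
  have "u *\<^sub>R x + v *\<^sub>R y - (u + v) *\<^sub>R c = u *\<^sub>R (x - c) + v *\<^sub>R (y - c)"
    by (simp add: algebra_simps)
  then have "N (u *\<^sub>R x + v *\<^sub>R y - c) \<le> u * N (x - c) + v * N (y - c)"
    using norm_add_le[of "u *\<^sub>R (x - c)" "v *\<^sub>R (y - c)"] uv by (simp add: norm_scale)
  also have "\<dots> \<le> r"
    using xy uv by (rule convex_bound_le)
  finally show "N (u *\<^sub>R x + v *\<^sub>R y - c) \<le> r" .
qed

text \<open>Balls are convex. This reduces circumradius and diameter of a hull to conditions on its
  generating points.\<close>

lemma hull_subset_norm_ball_iff:
  "convex hull S \<subseteq> {x. N (x - c) \<le> r} \<longleftrightarrow> (\<forall>x\<in>S. N (x - c) \<le> r)"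
  using hull_minimal[of S "{x. N (x - c) \<le> r}" convex] convex_norm_ball hull_subset[of S convex]
  by blast

section \<open>Comparison with the Euclidean norm and compactness of balls\<close>

lemma norm_lower_bound: "\<exists>b>0. \<forall>x. b * norm x \<le> N x"
proof -
  have "axis undefined 1 \<in> sphere (0 :: real ^ 'n) 1"
    by simp
  then have "sphere (0 :: real ^ 'n) 1 \<noteq> {}"
    by blast
  \<comment> \<open>The constant is the minimum of \<open>N\<close> on the Euclidean unit sphere,
    positive because it is attained at some \<open>u\<close> other than 0; homogeneity extends the
    bound to all vectors.\<close>
  then obtain u where u: "u \<in> sphere 0 1" and min: "\<And>x. x \<in> sphere 0 1 \<Longrightarrow> N u \<le> N x"
    using continuous_attains_inf[OF compact_sphere _ continuous_on_norm] by meson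
  have "N u * norm x \<le> N x" for x
  proof (cases "x = 0")
    case False
    then have "N u \<le> N ((1 / norm x) *\<^sub>R x)"
      by (intro min) simp
    with False show ?thesis
      by (simp add: norm_scale field_simps)
  qed (simp add: norm_nonneg)
  moreover have "0 < N u"
    using u norm_nonneg[of u] norm_eq_0_iff[of u] by force
  ultimately show ?thesis by blast
qed

lemma compact_norm_ball: "compact {c. N (a - c) \<le> r}"
proof -
  obtain b where b: "b > 0" "\<And>x. b * norm x \<le> N x"
    using norm_lower_bound by blast
  have "dist a c \<le> r / b" if "N (a - c) \<le> r" for c
    using b(1) b(2)[of "a - c"] that by (simp add: dist_norm field_simps)
  then have "bounded {c. N (a - c) \<le> r}"
    unfolding bounded_def by blast
  moreover have "closed {c. N (a - c) \<le> r}"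
    by (intro closed_Collect_le continuous_intros continuous_on_compose2[OF continuous_on_norm])
      auto
  ultimately show ?thesis
    by (simp add: compact_eq_bounded_closed)
qed

section \<open>Circumradius and diameter of convex hulls\<close>

lemma scaled_unit_ball:
  assumes "0 \<le> r"
  shows "(\<lambda>b. c + r *\<^sub>R b) ` unit_ball N = {x. N (x - c) \<le> r}"
proof (intro equalityI subsetI)
  fix x assume x: "x \<in> {x. N (x - c) \<le> r}"
  show "x \<in> (\<lambda>b. c + r *\<^sub>R b) ` unit_ball N"
  \<comment> \<open>The preimage of \<open>x\<close> is found by dividing by \<open>r\<close>; for
    radius 0 definiteness of \<open>N\<close> leaves only the centre.\<close>
  proof (cases "r = 0")
    case True
    with x norm_nonneg[of "x - c"] norm_eq_0_iff[of "x - c"] have "x = c" by simp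
    then show ?thesis
      using True norm_eq_0_iff[of 0] by (auto simp: unit_ball_def image_iff intro: exI[of _ 0])
  next
    case False
    then have "x = c + r *\<^sub>R ((1 / r) *\<^sub>R (x - c))" and "N ((1 / r) *\<^sub>R (x - c)) \<le> 1"
      using x assms unfolding norm_scale by (auto simp: field_simps)
    then show ?thesis
      unfolding unit_ball_def by blast
  qed
qed (use assms in \<open>auto simp: unit_ball_def norm_scale mult_left_le\<close>)

lemma translated_unit_ball: "(\<lambda>x. t + x) ` unit_ball N = {x. N (x - t) \<le> 1}"
  using scaled_unit_ball[of 1 t] by simp

lemma circumradius_hull:
  "circumradius N (convex hull S) = Inf {r. 0 \<le> r \<and> (\<exists>c. \<forall>x\<in>S. N (x - c) \<le> r)}"
  unfolding circumradius_def
  by (simp add: scaled_unit_ball hull_subset_norm_ball_iff cong: conj_cong)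

lemma circumradius_hull_le:
  assumes "0 \<le> r" "\<And>x. x \<in> S \<Longrightarrow> N (x - c) \<le> r"
  shows "circumradius N (convex hull S) \<le> r"
  unfolding circumradius_hull
proof (rule cInf_lower)
  show "bdd_below {r. 0 \<le> r \<and> (\<exists>c. \<forall>x\<in>S. N (x - c) \<le> r)}"
    by (rule bdd_belowI[of _ 0]) auto
qed (use assms in blast)

text \<open>The ball argument is applied once per variable: the ball of radius \<open>d\<close>
  about a point of \<open>S\<close> contains the hull, so the ball of radius \<open>d\<close> about
  a point of the hull contains \<open>S\<close> and hence the hull.\<close>

lemma norm_diff_hull_le:
  assumes "\<And>x y. x \<in> S \<Longrightarrow> y \<in> S \<Longrightarrow> N (x - y) \<le> d"
    and "x \<in> convex hull S" "y \<in> convex hull S"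
  shows "N (x - y) \<le> d"
proof -
  have "N (z - s) \<le> d" if "z \<in> convex hull S" "s \<in> S" for z s
    using that assms(1) hull_subset_norm_ball_iff[of S s d] by blast
  then have "N (z - x) \<le> d" if "z \<in> S" for z
    using that assms(2) norm_minus_commute by metis
  then show ?thesis
    using hull_subset_norm_ball_iff[of S x d] assms(3) norm_minus_commute by auto
qed

lemma diam_hull_le:
  assumes "S \<noteq> {}" "\<And>x y. x \<in> S \<Longrightarrow> y \<in> S \<Longrightarrow> N (x - y) \<le> d"
  shows "diam N (convex hull S) \<le> d"
  unfolding diam_def
proof (rule cSup_least)
  show "{N (x - y) |x y. x \<in> convex hull S \<and> y \<in> convex hull S} \<noteq> {}"
    using assms(1) hull_inc[of _ S convex] by blast
qed (use norm_diff_hull_le[OF assms(2)] in blast)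

lemma norm_diff_le_diam:
  assumes "finite S" "x \<in> S" "y \<in> S"
  shows "N (x - y) \<le> diam N (convex hull S)"
proof -
  \<comment> \<open>The supremum bounds its members only if the set is bounded above; the largest
    distance between points of the finite set \<open>S\<close> supplies the bound.\<close>
  define d where "d = Max ((\<lambda>(x, y). N (x - y)) ` (S \<times> S))"
  have "N (x - y) \<le> d" if "x \<in> S" "y \<in> S" for x y
    unfolding d_def using assms(1) that by (intro Max_ge) auto
  then have "bdd_above {N (x - y) | x y. x \<in> convex hull S \<and> y \<in> convex hull S}"
    using norm_diff_hull_le[of S d] by (auto intro!: bdd_aboveI[of _ d])
  then show ?thesis
    unfolding diam_def using assms(2,3) by (intro cSup_upper) (auto intro: hull_inc)
qed

text \<open>Ensures that the infimum defining the circumradius is taken over a nonempty set; the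
  ball about 0 with radius the sum of all norms serves.\<close>

lemma circumscribed_ball_exists:
  assumes "finite S"
  shows "\<exists>r\<ge>0. \<exists>c. \<forall>x\<in>S. N (x - c) \<le> r"
proof -
  have "\<forall>x\<in>S. N (x - 0) \<le> sum N S"
    using assms by (simp add: member_le_sum norm_nonneg)
  then show ?thesis
    using sum_nonneg[of S N] norm_nonneg by blast
qed

lemma diam_hull_le_twice_circumradius:
  assumes "finite S" "S \<noteq> {}"
  shows "diam N (convex hull S) \<le> 2 * circumradius N (convex hull S)"
proof -
  have "diam N (convex hull S) / 2 \<le> circumradius N (convex hull S)"
    unfolding circumradius_hull
  proof (rule cInf_greatest)
    fix r assume "r \<in> {r. 0 \<le> r \<and> (\<exists>c. \<forall>x\<in>S. N (x - c) \<le> r)}"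
    then obtain c where c: "\<forall>x\<in>S. N (x - c) \<le> r" by blast
    have "diam N (convex hull S) \<le> 2 * r"
    proof (rule diam_hull_le[OF assms(2)])
      fix x y assume "x \<in> S" "y \<in> S"
      then show "N (x - y) \<le> 2 * r"
        using bspec[OF c, of x] bspec[OF c, of y] norm_triangle[of x y c]
          norm_minus_commute[of c y] by simp
    qed
    then show "diam N (convex hull S) / 2 \<le> r" by simp
  qed (use circumscribed_ball_exists[OF assms(1)] in auto)
  then show ?thesis by simp
qed

text \<open>The infimum is attained by compactness: the centres admissible for radius
  \<open>r + 1 / Suc n\<close> form nested nonempty compact sets, and a common point of them is
  admissible for \<open>r\<close> itself.\<close>

lemma circumcenter_exists:
  assumes "finite S" "S \<noteq> {}" "circumradius N (convex hull S) \<le> r"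
  shows "\<exists>c. \<forall>x\<in>S. N (x - c) \<le> r"
proof -
  define F where "F n = (\<Inter>x\<in>S. {c. N (x - c) \<le> r + 1 / Suc n})" for n
  have "\<Inter> (range F) \<noteq> {}"
  proof (rule compact_nest)
    show "compact (F n)" for n
      \<comment> \<open>An intersection over an empty \<open>S\<close> would be the whole space, so
        nonemptiness enters here.\<close>
      unfolding F_def using assms(2) compact_norm_ball
      by (intro compact_Inter) auto
    show "F n \<noteq> {}" for n
    proof -
      have "circumradius N (convex hull S) < r + 1 / Suc n"
        using assms(3) by (rule order_le_less_trans) simp
      then obtain q where q: "0 \<le> q" "q < r + 1 / Suc n" "\<exists>c. \<forall>x\<in>S. N (x - c) \<le> q"
        unfolding circumradius_hull
        using circumscribed_ball_exists[OF assms(1)] cInf_lessD[of "{r. 0 \<le> r \<and> (\<exists>c. \<forall>x\<in>S. N (x - c) \<le> r)}"]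
        by blast
      then obtain c where "\<forall>x\<in>S. N (x - c) \<le> q" by blast
      with q(2) have "c \<in> F n"
        unfolding F_def by (auto intro: order_trans)
      then show ?thesis by blast
    qed
    show "F n \<subseteq> F k" if "k \<le> n" for k n
    proof -
      have "1 / real (Suc n) \<le> 1 / real (Suc k)"
        using that by (simp add: frac_le)
      then show ?thesis
        unfolding F_def by fastforce
    qed
  qed
  then obtain c where c: "\<And>n x. x \<in> S \<Longrightarrow> N (x - c) \<le> r + 1 / Suc n"
    unfolding F_def by blast
  have "N (x - c) \<le> r" if "x \<in> S" for x
  proof (rule field_le_epsilon)
    fix e :: real assume "0 < e"
    then obtain n where "1 / Suc n < e"
      using nat_approx_posE by blast
    then show "N (x - c) \<le> r + e"
      using c[OF that, of n] by linarith
  qed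
  then show ?thesis by blast
qed

section \<open>The intersection property as a statement about centres\<close>

lemma unit_balls_meet_iff: "(\<exists>x. N (x - s) \<le> 1 \<and> N (x - t) \<le> 1) \<longleftrightarrow> N (s - t) \<le> 2"
proof
  assume "\<exists>x. N (x - s) \<le> 1 \<and> N (x - t) \<le> 1"
  then obtain x where "N (x - s) \<le> 1" "N (x - t) \<le> 1" by blast
  then show "N (s - t) \<le> 2"
    using norm_triangle[of s t x] norm_minus_commute[of s x] by linarith
next
  assume "N (s - t) \<le> 2"
  \<comment> \<open>The midpoint lies at half the distance from either centre, so it is a common
    point.\<close>
  moreover have "midpoint s t - s = (1/2) *\<^sub>R (t - s)" "midpoint s t - t = (1/2) *\<^sub>R (s - t)"
    by (simp_all add: midpoint_def vec_eq_iff field_simps)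
  ultimately have "N (midpoint s t - s) \<le> 1" "N (midpoint s t - t) \<le> 1"
    using norm_minus_commute[of s t] by (simp_all only: norm_scale)
  then show "\<exists>x. N (x - s) \<le> 1 \<and> N (x - t) \<le> 1"
    by blast
qed

text \<open>Two-element index sets correspond to pairs of distinct indices; the diagonal pairs are
  harmless since \<open>N 0 = 0\<close>. By symmetry of \<open>N\<close>, a common point of the
  translates is the centre of a unit ball containing all \<open>t i\<close>.\<close>

lemma intersection_property_2_iff:
  "intersection_property m 2 (unit_ball N) \<longleftrightarrow>
    (\<forall>t. (\<forall>i<m. \<forall>j<m. N (t i - t j) \<le> 2) \<longrightarrow> (\<exists>c. \<forall>i<m. N (t i - c) \<le> 1))"
proof -
  have "(\<forall>J. J \<subseteq> {..<m} \<and> card J = 2 \<longrightarrow> (\<Inter>i\<in>J. (\<lambda>x. t i + x) ` unit_ball N) \<noteq> {}) \<longleftrightarrow>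
    (\<forall>i<m. \<forall>j<m. N (t i - t j) \<le> 2)" (is "?L \<longleftrightarrow> ?R") for t
  proof
    assume L: ?L
    show ?R
    proof (intro allI impI)
      fix i j assume "i < m" "j < m"
      show "N (t i - t j) \<le> 2"
      proof (cases "i = j")
        case True
        then show ?thesis using norm_eq_0_iff[of 0] by simp
      next
        case False
        with \<open>i < m\<close> \<open>j < m\<close> have "(\<Inter>k\<in>{i, j}. (\<lambda>x. t k + x) ` unit_ball N) \<noteq> {}"
          by (intro L[rule_format]) auto
        then show ?thesis
          unfolding unit_balls_meet_iff[symmetric] translated_unit_ball by blast
      qed
    qed
  next
    assume R: ?R
    show ?L
    proof (intro allI impI)
      fix J assume J: "J \<subseteq> {..<m} \<and> card J = 2"
      then obtain i j where ij: "J = {i, j}"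
        by (auto simp: card_2_iff)
      with J R have "N (t i - t j) \<le> 2" by auto
      then show "(\<Inter>i\<in>J. (\<lambda>x. t i + x) ` unit_ball N) \<noteq> {}"
        unfolding unit_balls_meet_iff[symmetric] translated_unit_ball ij by blast
    qed
  qed
  moreover have "(\<Inter>i\<in>{..<m}. (\<lambda>x. t i + x) ` unit_ball N) \<noteq> {} \<longleftrightarrow>
      (\<exists>c. \<forall>i<m. N (t i - c) \<le> 1)" for t
    unfolding translated_unit_ball by (auto simp: norm_minus_commute)
  ultimately show ?thesis
    unfolding intersection_property_def by simp
qed

section \<open>The two implications of the equivalence\<close>

lemma intersection_property_imp_diam_eq:
  assumes ip: "intersection_property m 2 (unit_ball N)" and "0 < m"
  shows "diam N (convex hull (p ` {..<m})) = 2 * circumradius N (convex hull (p ` {..<m}))"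
proof -
  define S where "S = p ` {..<m}"
  have S: "finite S" "S \<noteq> {}"
    using \<open>0 < m\<close> unfolding S_def by auto
  define d where "d = diam N (convex hull S)"
  have le_d: "N (p i - p j) \<le> d" if "i < m" "j < m" for i j
    unfolding d_def using S that by (intro norm_diff_le_diam) (auto simp: S_def)
  have "0 \<le> d"
    using le_d[of 0 0] norm_nonneg \<open>0 < m\<close> by (meson order_trans)
  have "\<exists>c. \<forall>x\<in>S. N (x - c) \<le> d / 2"
  \<comment> \<open>For \<open>d = 0\<close> all points coincide and any of them is a centre;
    otherwise scaling by \<open>2 / d\<close> brings the pairwise distances down to at most
    2.\<close>
  proof (cases "d = 0")
    case True
    then show ?thesis
      using le_d \<open>0 < m\<close> unfolding S_def by auto
  next
    case False
    with \<open>0 \<le> d\<close> have "0 < d" by simp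
    have "N ((2 / d) *\<^sub>R p i - (2 / d) *\<^sub>R p j) \<le> 2" if "i < m" "j < m" for i j
    proof -
      have "N ((2 / d) *\<^sub>R p i - (2 / d) *\<^sub>R p j) = (2 / d) * N (p i - p j)"
        using norm_scale[of "2 / d" "p i - p j"] \<open>0 < d\<close> by (simp add: scaleR_right_diff_distrib)
      also have "\<dots> \<le> (2 / d) * d"
        using le_d[OF that] \<open>0 < d\<close> by (intro mult_left_mono) auto
      finally show ?thesis using \<open>0 < d\<close> by simp
    qed
    then obtain c where c: "\<And>i. i < m \<Longrightarrow> N ((2 / d) *\<^sub>R p i - c) \<le> 1"
      using ip[unfolded intersection_property_2_iff, rule_format, of "\<lambda>i. (2 / d) *\<^sub>R p i"] by blast
    \<comment> \<open>Undoing the scaling turns the unit ball about \<open>c\<close> into a ball of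
      radius \<open>d / 2\<close>.\<close>
    have "N (p i - (d / 2) *\<^sub>R c) \<le> d / 2" if "i < m" for i
    proof -
      have "p i - (d / 2) *\<^sub>R c = (d / 2) *\<^sub>R ((2 / d) *\<^sub>R p i - c)"
        using \<open>0 < d\<close> by (simp add: scaleR_right_diff_distrib)
      then show ?thesis
        using c[OF that] \<open>0 < d\<close> by (simp add: norm_scale mult_left_le)
    qed
    then show ?thesis unfolding S_def by blast
  qed
  then have "circumradius N (convex hull S) \<le> d / 2"
    using \<open>0 \<le> d\<close> circumradius_hull_le by (metis divide_nonneg_nonneg zero_le_numeral)
  then show ?thesis
    using diam_hull_le_twice_circumradius[OF S] unfolding d_def S_def by linarith
qed

text \<open>Pairwise distances at most 2 give diameter at most 2, so circumradius at most 1. As an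
  infimum this only yields balls of radius arbitrarily close to 1;
  \<open>circumcenter_exists\<close> provides one of radius 1.\<close>

lemma diam_eq_imp_intersection_property:
  assumes eq: "\<And>p :: nat \<Rightarrow> real ^ 'n.
      diam N (convex hull (p ` {..<m})) = 2 * circumradius N (convex hull (p ` {..<m}))"
    and "0 < m"
  shows "intersection_property m 2 (unit_ball N)"
  unfolding intersection_property_2_iff
proof (intro allI impI)
  fix t :: "nat \<Rightarrow> real ^ 'n"
  assume t: "\<forall>i<m. \<forall>j<m. N (t i - t j) \<le> 2"
  have S: "finite (t ` {..<m})" "t ` {..<m} \<noteq> {}"
    using \<open>0 < m\<close> by auto
  have "diam N (convex hull (t ` {..<m})) \<le> 2"
    using t by (intro diam_hull_le[OF S(2)]) auto
  then have "circumradius N (convex hull (t ` {..<m})) \<le> 1"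
    using eq[of t] by simp
  from circumcenter_exists[OF S this] show "\<exists>c. \<forall>i<m. N (t i - c) \<le> 1"
    by auto
qed

end

theorem lemma4p3:
  fixes N :: "real ^ 'n \<Rightarrow> real" and m :: nat
  assumes "CARD('n) \<ge> 2"
    and "is_norm N"
    and "m \<ge> 3"
  shows "intersection_property m 2 (unit_ball N) \<longleftrightarrow>
    (\<forall>p :: nat \<Rightarrow> real ^ 'n.
       diam N (convex hull (p ` {..<m})) = 2 * circumradius N (convex hull (p ` {..<m})))"
proof -
  have "0 < m" using \<open>m \<ge> 3\<close> by simp
  then show ?thesis
    using intersection_property_imp_diam_eq[OF \<open>is_norm N\<close>]
      diam_eq_imp_intersection_property[OF \<open>is_norm N\<close>] by blast
qed

end
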